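(* Let $d\ge 1$ be any integer constant and let $G$ be the $d$-dimensional grid graph on $n$ vertices. Then, as $n\to\infty$, the maximum load $X_{\max}^{(n)}$ after $n$ balls are allocated to the vertices of $G$ by the local search allocation (with ties broken uniformly at random) is $\Theta\Big(\big(\frac{\log n}{\log\log n}\big)^{\frac{1}{d+1}}\Big)$ with probability $1-o(1)$; that is, there are constants $0<c\le C<\infty$ depending only on $d$ such that $$\Pr\Big[\,c\Big(\frac{\log n}{\log\log n}\Big)^{\frac1{d+1}}\le X_{\max}^{(n)}\le C\Big(\frac{\log n}{\log\log n}\Big)^{\frac1{d+1}}\Big]\to 1\quad\text{as } n\to\infty.$$
   Context: The $d$-dimensional grid on $n$ vertices (where $n^{1/d}$ is an integer) has vertex set $V=\{u=(u_1,\dots,u_d): u_i\in\{0,\dots,n^{1/d}-1\}\}$ and edge set $\{\{u,v\}:\mathrm{dist}(u,v)=1\}$, where $\mathrm{dist}(u,v)=\sum_{i=1}^d \min\{|u_i-v_i|,\,n^{1/d}-|u_i-v_i|\}$. Local search allocation on a finite, undirected, connected graph $G=(V,E)$ with $|V|=n$: the vertices are bins, all initially with load $0$. Balls $1,2,\dots$ are allocated one after another. Ball $i$ is born at a vertex $U_i$ (its birthplace), where $U_1,U_2,\dots$ are independent and uniform on $V$. Starting at $U_i$, as long as the current vertex has a neighbor whose load is strictly smaller than the load of the current vertex, the ball moves to a neighbor of smallest load; ties among the neighbors of smallest load are broken uniformly at random, independently. The search stops at the first vertex none of whose neighbors has a smaller load (a local minimum); the ball is placed there and the load of that vertex increases by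 $1$. $X_v^{(i)}$ is the load of $v$ right after ball $i$ is placed, and $X_{\max}^{(n)}=\max_{v\in V}X_v^{(n)}$. *)

theory Defs
  imports "HOL-Probability.Probability"
begin

section \<open>Local search allocation on a graph\<close>

text \<open>
  A graph is given by its vertex set and its set of undirected edges, which are two-element sets.
  A load configuration assigns to every vertex the number of balls it holds.
\<close>

definition neighbors :: "'v set set \<Rightarrow> 'v \<Rightarrow> 'v set" where
  "neighbors E v = {w. {v, w} \<in> E}"

definition min_load_neighbors :: "'v set set \<Rightarrow> ('v \<Rightarrow> nat) \<Rightarrow> 'v \<Rightarrow> 'v set" where
  "min_load_neighbors E x v = {w \<in> neighbors E v. \<forall>w' \<in> neighbors E v. x w \<le> x w'}"

lemma min_load_neighbors_less:
  assumes "finite (neighbors E v)" "\<exists>w \<in> neighbors E v. x w < x v"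
    and "w \<in> set_pmf (pmf_of_set (min_load_neighbors E x v))"
  shows "x w < x v"
proof -
  obtain u where u: "u \<in> neighbors E v" "x u < x v"
    using assms(2) by blast
  have "finite (min_load_neighbors E x v)"
    using assms(1) by (simp add: min_load_neighbors_def)
  moreover have "arg_min_on x (neighbors E v) \<in> min_load_neighbors E x v"
    using arg_min_if_finite(1)[of "neighbors E v" x] arg_min_least[of "neighbors E v" _ x] assms(1) u(1)
    by (auto simp: min_load_neighbors_def)
  ultimately have "w \<in> min_load_neighbors E x v"
    using assms(3) by (metis empty_iff set_pmf_of_set)
  then show ?thesis
    using u by (auto simp: min_load_neighbors_def intro: le_less_trans)
qed

text \<open>
  The law of the final position of a ball that searches from the vertex \<open>v\<close> in the
  configuration \<open>x\<close>. The finiteness test only serves to make the function total; it always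
  succeeds in a finite graph.
\<close>

function local_search :: "'v set set \<Rightarrow> ('v \<Rightarrow> nat) \<Rightarrow> 'v \<Rightarrow> 'v pmf" where
  "local_search E x v =
     (if finite (neighbors E v) \<and> (\<exists>w \<in> neighbors E v. x w < x v)
      then bind_pmf (pmf_of_set (min_load_neighbors E x v)) (\<lambda>w. local_search E x w)
      else return_pmf v)"
  by pat_completeness auto
termination
  by (relation "Wellfounded.measure (\<lambda>(E, x, v). x v)") (auto dest: min_load_neighbors_less)

declare local_search.simps [simp del]

definition allocate_ball ::
    "'v set \<Rightarrow> 'v set set \<Rightarrow> ('v \<Rightarrow> nat) \<Rightarrow> ('v \<Rightarrow> nat) pmf" where
  "allocate_ball V E x =
     do {
       u \<leftarrow> pmf_of_set V;
       v \<leftarrow> local_search E x u;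
       return_pmf (x(v := x v + 1))
     }"

text \<open>
  The law of the load configuration after a given number of balls. Each ball draws its birthplace
  and breaks its ties with fresh randomness, so only the previous configuration matters.
\<close>

primrec loads :: "'v set \<Rightarrow> 'v set set \<Rightarrow> nat \<Rightarrow> ('v \<Rightarrow> nat) pmf" where
  "loads V E 0 = return_pmf (\<lambda>_. 0)"
| "loads V E (Suc k) = bind_pmf (loads V E k) (allocate_ball V E)"

definition max_load :: "'v set \<Rightarrow> ('v \<Rightarrow> nat) \<Rightarrow> nat" where
  "max_load V x = Max (x ` V)"


section \<open>The \<open>d\<close>-dimensional grid\<close>

text \<open>
  The grid with side length \<open>m\<close> has \<open>n = m ^ d\<close> vertices. Distances are cyclic in every
  coordinate and are computed in the integers, so that no subtraction is truncated.
\<close>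

definition grid_vertices :: "nat \<Rightarrow> nat \<Rightarrow> (nat \<Rightarrow> nat) set" where
  "grid_vertices d m = PiE {1..d} (\<lambda>_. {..<m})"

definition grid_dist :: "nat \<Rightarrow> nat \<Rightarrow> (nat \<Rightarrow> nat) \<Rightarrow> (nat \<Rightarrow> nat) \<Rightarrow> int" where
  "grid_dist d m u v =
     (\<Sum>i=1..d. min \<bar>int (u i) - int (v i)\<bar> (int m - \<bar>int (u i) - int (v i)\<bar>))"

definition grid_edges :: "nat \<Rightarrow> nat \<Rightarrow> (nat \<Rightarrow> nat) set set" where
  "grid_edges d m =
     {{u, v} | u v. u \<in> grid_vertices d m \<and> v \<in> grid_vertices d m \<and> grid_dist d m u v = 1}"

lemma finite_grid_vertices: "finite (grid_vertices d m)"
  by (simp add: grid_vertices_def finite_PiE)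

lemma card_grid_vertices: "card (grid_vertices d m) = m ^ d"
  by (simp add: grid_vertices_def card_PiE)

lemma grid_dist_commute: "grid_dist d m u v = grid_dist d m v u"
  by (simp add: grid_dist_def abs_minus_commute)

lemma neighbors_grid:
  assumes "u \<in> grid_vertices d m"
  shows "neighbors (grid_edges d m) u = {v \<in> grid_vertices d m. grid_dist d m u v = 1}"
  using assms grid_dist_commute[of d m]
  by (auto simp: neighbors_def grid_edges_def doubleton_eq_iff)

end

theory Submission
  imports Defs "HOL-Real_Asymp.Real_Asymp"
begin

text \<open>
  Each step of a search lowers the load, so a ball travels at most as far as the current maximum
  load \<open>M\<close>, and the loads of adjacent vertices differ by at most one. Both bounds therefore follow
  from the numbers of balls born at the vertices, whatever the tie-breaking.

  Lower bound: the balls born at \<open>v\<close> all end in the ball of radius \<open>M\<close> around \<open>v\<close>, so at most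
  \<open>M * (2 * M + 1) ^ d\<close> balls are born at \<open>v\<close>, while by the second moment method some vertex has
  about \<open>ln n / (2 * ln (ln n))\<close> births.

  Upper bound: at the first time some vertex \<open>v\<close> reaches load \<open>M\<close>, a box of side \<open>M / (2 * d)\<close> at
  \<open>v\<close> has loads at least \<open>M / 2\<close>, so order \<open>M ^ (d + 1)\<close> balls were born in the ball of radius
  \<open>2 * M\<close> around \<open>v\<close>, which has order \<open>M ^ d\<close> vertices. A Chernoff bound with parameter
  \<open>sqrt M\<close> and a union bound over \<open>v\<close> show that this is unlikely once
  \<open>M ^ (d + 1) * ln M\<close> is a large multiple of \<open>ln n\<close>.
\<close>

section \<open>Transport of balls\<close>

text \<open>Edges are unordered, so the one-sided inequality bounds the difference in both
  directions.\<close>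

definition lipschitz_loads :: "'v set set \<Rightarrow> ('v \<Rightarrow> nat) \<Rightarrow> bool" where
  "lipschitz_loads E x \<longleftrightarrow> (\<forall>v w. {v, w} \<in> E \<longrightarrow> x v \<le> Suc (x w))"

primrec births :: "'v set \<Rightarrow> nat \<Rightarrow> ('v \<Rightarrow> nat) pmf" where
  "births V 0 = return_pmf (\<lambda>_. 0)"
| "births V (Suc k) =
     do {
       b \<leftarrow> births V k;
       u \<leftarrow> pmf_of_set V;
       return_pmf (b(u := b u + 1))
     }"

text \<open>A coupling of the allocation with its birthplaces. Its two marginals are
  \<open>loads\<close> and \<open>births\<close>, so an inequality valid on its support carries over
  to probabilities.\<close>

primrec loads_births :: "'v set \<Rightarrow> 'v set set \<Rightarrow> nat \<Rightarrow> (('v \<Rightarrow> nat) \<times> ('v \<Rightarrow> nat)) pmf" where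
  "loads_births V E 0 = return_pmf (\<lambda>_. 0, \<lambda>_. 0)"
| "loads_births V E (Suc k) =
     do {
       (x, b) \<leftarrow> loads_births V E k;
       u \<leftarrow> pmf_of_set V;
       v \<leftarrow> local_search E x u;
       return_pmf (x(v := x v + 1), b(u := b u + 1))
     }"

lemma map_fst_loads_births: "map_pmf fst (loads_births V E k) = loads V E k"
proof (induction k)
  case (Suc k)
  have "map_pmf fst (loads_births V E (Suc k)) =
      bind_pmf (loads_births V E k) (\<lambda>xb. allocate_ball V E (fst xb))"
    by (simp add: map_bind_pmf allocate_ball_def case_prod_beta)
  then show ?case
    by (simp add: Suc.IH[symmetric] bind_map_pmf)
qed simp

lemma map_snd_loads_births: "map_pmf snd (loads_births V E k) = births V k"
proof (induction k)
  case (Suc k)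
  have "map_pmf snd (loads_births V E (Suc k)) =
      bind_pmf (loads_births V E k)
        (\<lambda>xb. bind_pmf (pmf_of_set V) (\<lambda>u. return_pmf ((snd xb)(u := snd xb u + 1))))"
    by (simp add: map_bind_pmf case_prod_beta)
  then show ?case
    by (simp add: Suc.IH[symmetric] bind_map_pmf)
qed simp

lemma sum_fun_upd_Suc:
  fixes x :: "'v \<Rightarrow> nat"
  assumes "finite S"
  shows "sum (x(v := Suc (x v))) S = sum x S + of_bool (v \<in> S)"
proof -
  have "sum (x(v := Suc (x v))) S = (\<Sum>u\<in>S. x u + of_bool (u = v))"
    by (intro sum.cong) auto
  also have "\<dots> = sum x S + (\<Sum>u\<in>S. of_bool (u = v))"
    by (simp add: sum.distrib)
  also have "(\<Sum>u\<in>S. of_bool (u = v)) = (of_bool (v \<in> S) :: nat)"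
    using assms by (simp add: of_bool_def sum.delta)
  finally show ?thesis .
qed

text \<open>\<open>D\<close> stands for a distance, of which only the growth by at most one across
  an edge is recorded. Symmetry is not among the assumptions, hence the separate neighbourhoods
  \<open>nbhd_in\<close> and \<open>nbhd_out\<close>.\<close>

locale search_graph =
  fixes V :: "'v set" and E :: "'v set set" and D :: "'v \<Rightarrow> 'v \<Rightarrow> int"
  assumes finite_V: "finite V"
    and V_nonempty: "V \<noteq> {}"
    and edge_in_V: "{v, w} \<in> E \<Longrightarrow> v \<in> V"
    and D_refl: "D v v = 0"
    and D_edge: "{v, w} \<in> E \<Longrightarrow> u \<in> V \<Longrightarrow> D v u \<le> D w u + 1"
begin

lemma finite_neighbors: "finite (neighbors E v)"
proof (rule finite_subset[OF _ finite_V])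
  show "neighbors E v \<subseteq> V"
    using edge_in_V by (auto simp: neighbors_def insert_commute)
qed

text \<open>Every move lowers the load by at least one and costs at most one unit of distance, so
  the drop in load pays for the way travelled. The induction follows the load of the current
  vertex.\<close>

lemma local_search_support:
  assumes "u \<in> set_pmf (local_search E x v)" "v \<in> V"
  shows "u \<in> V \<and> D v u \<le> int (x v) - int (x u) \<and> (\<forall>w \<in> neighbors E u. x u \<le> x w)"
  using assms
proof (induction "x v" arbitrary: v rule: less_induct)
  case less
  show ?case
  proof (cases "\<exists>w \<in> neighbors E v. x w < x v")
    case True
    then obtain w where w: "w \<in> set_pmf (pmf_of_set (min_load_neighbors E x v))"
        "u \<in> set_pmf (local_search E x w)"
      using less.prems(1) finite_neighbors
      by (subst (asm) local_search.simps) auto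
    have *: "x w < x v"
      using min_load_neighbors_less[OF finite_neighbors True w(1)] .
    have fin: "finite (min_load_neighbors E x v)"
      using finite_neighbors[of v] by (simp add: min_load_neighbors_def)
    have ne: "min_load_neighbors E x v \<noteq> {}"
    proof -
      have "arg_min_on x (neighbors E v) \<in> min_load_neighbors E x v"
        using arg_min_if_finite(1)[OF finite_neighbors, of v x] True
          arg_min_least[OF finite_neighbors, of v _ x]
        by (auto simp: min_load_neighbors_def)
      then show ?thesis by auto
    qed
    have e: "{v, w} \<in> E"
      using w(1) fin ne by (simp add: min_load_neighbors_def neighbors_def)
    have "w \<in> V"
      using e edge_in_V[of w v] by (simp add: insert_commute)
    note IH = less.hyps[OF * w(2) this]
    moreover have "D v u \<le> D w u + 1"
      using D_edge[OF e] IH by blast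
    ultimately show ?thesis
      using * by auto
  next
    case False
    then have "u = v"
      using less.prems(1) by (subst (asm) local_search.simps) auto
    then show ?thesis
      using False less.prems(2) by (auto simp: D_refl not_less)
  qed
qed

text \<open>Pathwise induction over the balls. The step keeps only what the later arguments use of a
  search from \<open>u\<close> to \<open>v\<close>: the distance bound, and that \<open>v\<close> is
  a local minimum.\<close>

lemma loads_births_induct [consumes 1, case_names init step]:
  assumes "(x, b) \<in> set_pmf (loads_births V E k)"
    and "P (\<lambda>_. 0) (\<lambda>_. 0)"
    and "\<And>x b u v. P x b \<Longrightarrow> u \<in> V \<Longrightarrow> v \<in> V \<Longrightarrow> D u v \<le> int (x u) \<Longrightarrow>
      (\<And>w. {v, w} \<in> E \<Longrightarrow> x v \<le> x w) \<Longrightarrow> P (x(v := Suc (x v))) (b(u := Suc (b u)))"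
  shows "P x b"
  using assms(1)
proof (induction k arbitrary: x b)
  case 0
  then show ?case using assms(2) by simp
next
  case (Suc k)
  then obtain x' b' u v where *: "(x', b') \<in> set_pmf (loads_births V E k)"
      "u \<in> set_pmf (pmf_of_set V)" "v \<in> set_pmf (local_search E x' u)"
      "x = x'(v := Suc (x' v))" "b = b'(u := Suc (b' u))"
    by (force simp: case_prod_beta)
  have u: "u \<in> V"
    using *(2) by (simp add: finite_V V_nonempty)
  note ls = local_search_support[OF *(3) u]
  show ?case
    unfolding *(4,5) using ls
    by (intro assms(3) Suc.IH[OF *(1)] u) (auto simp: neighbors_def)
qed

text \<open>Only a local minimum gains a ball, so afterwards it exceeds each neighbour by at most
  one.\<close>

lemma lipschitz_loads_births:
  assumes "(x, b) \<in> set_pmf (loads_births V E k)"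
  shows "lipschitz_loads E x"
  using assms
proof (induction rule: loads_births_induct)
  case init
  then show ?case by (simp add: lipschitz_loads_def)
next
  case (step x b u v)
  then show ?case
    by (auto simp: lipschitz_loads_def insert_commute intro: le_SucI)
qed

section \<open>Balls entering and leaving a vertex set\<close>

definition nbhd_in :: "nat \<Rightarrow> 'v set \<Rightarrow> 'v set" where
  "nbhd_in M S = {w \<in> V. \<exists>u\<in>S. D w u \<le> int M}"

definition nbhd_out :: "nat \<Rightarrow> 'v set \<Rightarrow> 'v set" where
  "nbhd_out M S = {w \<in> V. \<exists>u\<in>S. D u w \<le> int M}"

lemma finite_nbhd: "finite (nbhd_in M S)" "finite (nbhd_out M S)"
  by (simp_all add: nbhd_in_def nbhd_out_def finite_V)

text \<open>A ball that ends in \<open>S\<close> has travelled at most the load of its birthplace,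
  hence at most \<open>M\<close>, so it was born in \<open>nbhd_in M S\<close>.\<close>

lemma loads_le_births:
  assumes "(x, b) \<in> set_pmf (loads_births V E k)" "S \<subseteq> V" "\<And>v. v \<in> V \<Longrightarrow> x v \<le> M"
  shows "sum x S \<le> sum b (nbhd_in M S)"
  using assms(1,3)
proof (induction rule: loads_births_induct)
  case (step x b u v)
  \<comment> \<open>Loads never decrease, so the bound on the final loads also holds before this
    ball.\<close>
  have le: "x w \<le> M" if "w \<in> V" for w
    using step.prems[OF that] by (auto split: if_splits)
  have "v \<in> S \<Longrightarrow> u \<in> nbhd_in M S"
    using step.hyps le[of u] by (force simp: nbhd_in_def)
  then show ?case
    unfolding sum_fun_upd_Suc[OF finite_subset[OF assms(2) finite_V]] sum_fun_upd_Suc[OF finite_nbhd(1)]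
    using step.IH[OF le] by auto
qed simp

text \<open>The mirror image: a ball born in \<open>S\<close> ends in
  \<open>nbhd_out M S\<close>.\<close>

lemma births_le_loads:
  assumes "(x, b) \<in> set_pmf (loads_births V E k)" "S \<subseteq> V" "\<And>v. v \<in> V \<Longrightarrow> x v \<le> M"
  shows "sum b S \<le> sum x (nbhd_out M S)"
  using assms(1,3)
proof (induction rule: loads_births_induct)
  case (step x b u v)
  have le: "x w \<le> M" if "w \<in> V" for w
    using step.prems[OF that] by (auto split: if_splits)
  have "u \<in> S \<Longrightarrow> v \<in> nbhd_out M S"
    using step.hyps le[of u] by (force simp: nbhd_out_def)
  then show ?case
    unfolding sum_fun_upd_Suc[OF finite_subset[OF assms(2) finite_V]] sum_fun_upd_Suc[OF finite_nbhd(2)]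
    using step.IH[OF le] by auto
qed simp

text \<open>The configuration \<open>y\<close> is the one at the first time at which some load reaches \<open>M\<close>.\<close>

lemma first_time_load:
  assumes "(x, b) \<in> set_pmf (loads_births V E k)" "v \<in> V" "M \<le> x v"
  shows "\<exists>y v. v \<in> V \<and> y v = M \<and> lipschitz_loads E y \<and>
    (\<forall>S\<subseteq>V. sum y S \<le> sum b (nbhd_in M S))"
proof (cases M)
  case 0
  then show ?thesis
    using assms(2) by (intro exI[of _ "\<lambda>_. 0"] exI[of _ v]) (simp add: lipschitz_loads_def)
next
  case (Suc M')
  show ?thesis
    using assms
  proof (induction k arbitrary: x b v)
    case 0
    then show ?case using Suc by simp
  next
    case (Suc k)
    from Suc.prems(1) obtain x' b' u v' where *: "(x', b') \<in> set_pmf (loads_births V E k)"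
        "x = x'(v' := Suc (x' v'))" "b = b'(u := Suc (b' u))"
      by (force simp: case_prod_beta)
    show ?case
    proof (cases "\<exists>w\<in>V. M \<le> x' w")
      case True
      then obtain y w where y: "w \<in> V" "y w = M" "lipschitz_loads E y"
          "\<forall>S\<subseteq>V. sum y S \<le> sum b' (nbhd_in M S)"
        using Suc.IH[OF *(1)] by metis
      \<comment> \<open>The level was reached earlier; later births can only enlarge the right-hand
        side.\<close>
      have "sum b' A \<le> sum b A" for A
        unfolding *(3) by (intro sum_mono) auto
      then have "\<forall>S\<subseteq>V. sum y S \<le> sum b (nbhd_in M S)"
        using y(4) order_trans by blast
      then show ?thesis
        using y(1-3) by blast
    next
      case False
      \<comment> \<open>The last ball raises a single load by one, so no load overshoots
        \<open>M\<close> and the current configuration serves as \<open>y\<close>.\<close>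
      then have le: "x w \<le> M" if "w \<in> V" for w
        using that *(2) by (auto simp: not_le)
      have "x v = M"
        using le[OF Suc.prems(2)] Suc.prems(3) by simp
      then show ?thesis
        using lipschitz_loads_births[OF Suc.prems(1)] loads_le_births[OF Suc.prems(1) _ le]
          Suc.prems(2) by blast
    qed
  qed
qed

end

section \<open>Geometry of the grid\<close>

lemma cyclic_dist_triangle:
  fixes a b c m :: int
  assumes "0 \<le> a" "a < m" "0 \<le> b" "b < m" "0 \<le> c" "c < m"
  shows "min \<bar>a - c\<bar> (m - \<bar>a - c\<bar>) \<le>
    min \<bar>a - b\<bar> (m - \<bar>a - b\<bar>) + min \<bar>b - c\<bar> (m - \<bar>b - c\<bar>)"
  using assms by (simp add: min_def abs_if split: if_splits)

lemma grid_vertices_less: "u \<in> grid_vertices d m \<Longrightarrow> i \<in> {1..d} \<Longrightarrow> u i < m"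
  by (auto simp: grid_vertices_def)

lemma grid_dist_triangle:
  assumes "u \<in> grid_vertices d m" "v \<in> grid_vertices d m" "w \<in> grid_vertices d m"
  shows "grid_dist d m u w \<le> grid_dist d m u v + grid_dist d m v w"
  unfolding grid_dist_def sum.distrib[symmetric]
  using assms by (intro sum_mono cyclic_dist_triangle) (auto simp: grid_vertices_less)

lemma grid_dist_refl: "grid_dist d m u u = 0"
  by (simp add: grid_dist_def)

lemma grid_edge_iff:
  "{u, v} \<in> grid_edges d m \<longleftrightarrow>
     u \<in> grid_vertices d m \<and> v \<in> grid_vertices d m \<and> grid_dist d m u v = 1"
  using grid_dist_commute[of d m] by (auto simp: grid_edges_def doubleton_eq_iff)

lemma search_graph_grid:
  assumes "m \<ge> 1"
  shows "search_graph (grid_vertices d m) (grid_edges d m) (grid_dist d m)"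
proof
  show "grid_vertices d m \<noteq> {}"
    using assms by (auto simp: grid_vertices_def PiE_eq_empty_iff lessThan_empty_iff)
next
  fix v w u
  assume "{v, w} \<in> grid_edges d m" "u \<in> grid_vertices d m"
  then show "grid_dist d m v u \<le> grid_dist d m w u + 1"
    using grid_dist_triangle[of v d m w u] by (auto simp: grid_edge_iff)
qed (auto simp: finite_grid_vertices grid_dist_refl grid_edge_iff)

text \<open>Translation of \<open>v\<close> by \<open>a\<close> on the torus. The restriction makes
  the result extensional, as membership in \<open>grid_vertices\<close> demands.\<close>

definition grid_shift :: "nat \<Rightarrow> nat \<Rightarrow> (nat \<Rightarrow> nat) \<Rightarrow> (nat \<Rightarrow> nat) \<Rightarrow> nat \<Rightarrow> nat" where
  "grid_shift d m v a = restrict (\<lambda>i. (v i + a i) mod m) {1..d}"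

lemma grid_shift_in: "m \<ge> 1 \<Longrightarrow> grid_shift d m v a \<in> grid_vertices d m"
  by (auto simp: grid_shift_def grid_vertices_def)

text \<open>The shift is reached by a path that raises one coordinate by one at a time, and each
  unit is an edge. The function \<open>f\<close> will be a load configuration or a negated
  distance.\<close>

lemma grid_shift_lipschitz:
  fixes f :: "(nat \<Rightarrow> nat) \<Rightarrow> int"
  assumes f: "\<And>u w. {u, w} \<in> grid_edges d m \<Longrightarrow> f u \<le> f w + 1"
    and m: "m \<ge> 2" and v: "v \<in> grid_vertices d m"
  shows "f v \<le> f (grid_shift d m v a) + int (\<Sum>i=1..d. a i)"
proof (induction "\<Sum>i=1..d. a i" arbitrary: a)
  case 0
  then have "\<forall>i\<in>{1..d}. a i = 0"
    by simp
  then have "grid_shift d m v a = v"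
    using v by (auto simp: grid_shift_def grid_vertices_def fun_eq_iff PiE_def
        extensional_def Pi_def)
  then show ?case by (simp add: sum_nonneg)
next
  case (Suc n)
  then obtain i where i: "i \<in> {1..d}" "a i \<noteq> 0"
    by (metis sum.neutral nat.distinct(1))
  define a' where "a' = a(i := a i - 1)"
  have a: "a = a'(i := Suc (a' i))"
    using i(2) by (auto simp: a'_def)
  have sum_a: "(\<Sum>i=1..d. a i) = Suc (\<Sum>i=1..d. a' i)"
    using i(1) by (subst a, subst sum_fun_upd_Suc) auto
  have "grid_dist d m (grid_shift d m v a') (grid_shift d m v a) =
      (\<Sum>j=1..d. if j = i then 1 else 0)"
    unfolding grid_dist_def
  proof (intro sum.cong refl)
    fix j assume j: "j \<in> {1..d}"
    show "min \<bar>int (grid_shift d m v a' j) - int (grid_shift d m v a j)\<bar>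
        (int m - \<bar>int (grid_shift d m v a' j) - int (grid_shift d m v a j)\<bar>) =
        (if j = i then 1 else 0)"
    proof (cases "j = i")
      case True
      \<comment> \<open>A cyclic successor adds one or wraps from \<open>m - 1\<close> to 0; as
        \<open>m \<ge> 2\<close>, the cyclic distance is one in both cases.\<close>
      have "int (Suc s mod m) = int (s mod m) + 1 \<or>
          (int (Suc s mod m) = 0 \<and> int (s mod m) = int m - 1)" for s
        using m by (auto simp: mod_Suc)
      from this[of "v i + a' i"] show ?thesis
        using True i(1) m by (auto simp: grid_shift_def a)
    qed (use j in \<open>auto simp: grid_shift_def a\<close>)
  qed
  also have "\<dots> = 1"
    using i(1) by (simp add: sum.delta)
  finally have "f (grid_shift d m v a') \<le> f (grid_shift d m v a) + 1"
    using m by (intro f) (auto simp: grid_edge_iff grid_shift_in)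
  moreover have "f v \<le> f (grid_shift d m v a') + int (\<Sum>i=1..d. a' i)"
    using Suc(1)[of a'] Suc(2) sum_a by simp
  ultimately show ?case
    using sum_a by simp
qed

lemma grid_dist_shift:
  assumes "m \<ge> 2" "v \<in> grid_vertices d m"
  shows "grid_dist d m (grid_shift d m v a) v \<le> int (\<Sum>i=1..d. a i)"
proof -
  have "- grid_dist d m v v \<le> - grid_dist d m (grid_shift d m v a) v + int (\<Sum>i=1..d. a i)"
  proof (rule grid_shift_lipschitz[OF _ assms])
    fix u w assume "{u, w} \<in> grid_edges d m"
    then show "- grid_dist d m u v \<le> - grid_dist d m w v + 1"
      using grid_dist_triangle[of w d m u v] assms(2) by (auto simp: grid_edge_iff grid_dist_commute)
  qed
  then show ?thesis by (simp add: grid_dist_refl)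
qed

definition grid_box :: "nat \<Rightarrow> nat \<Rightarrow> (nat \<Rightarrow> nat) \<Rightarrow> nat \<Rightarrow> (nat \<Rightarrow> nat) set" where
  "grid_box d m v r = grid_shift d m v ` PiE {1..d} (\<lambda>_. {..r})"

text \<open>Shifts with entries below \<open>m\<close> are determined by their residues, so
  translation is injective on them.\<close>

lemma card_grid_box:
  assumes "r < m"
  shows "card (grid_box d m v r) = Suc r ^ d"
proof -
  have "inj_on (grid_shift d m v) (PiE {1..d} (\<lambda>_. {..r}))"
  proof (rule inj_onI)
    fix a a' assume a: "a \<in> PiE {1..d} (\<lambda>_. {..r})" "a' \<in> PiE {1..d} (\<lambda>_. {..r})"
      and eq: "grid_shift d m v a = grid_shift d m v a'"
    show "a = a'"
    proof (rule PiE_ext[OF a])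
      fix i assume i: "i \<in> {1..d}"
      have "(v i + a i) mod m = (v i + a' i) mod m"
        using fun_cong[OF eq, of i] i by (simp add: grid_shift_def)
      \<comment> \<open>In the integers \<open>v i\<close> can be cancelled from the congruence
        without truncation.\<close>
      then have "(int (v i) + int (a i)) mod int m = (int (v i) + int (a' i)) mod int m"
        by (metis of_nat_add of_nat_mod)
      from mod_diff_cong[OF this refl, of "int (v i)"] have "a i mod m = a' i mod m"
        by (simp flip: of_nat_mod)
      moreover have "a i < m" "a' i < m"
        using a i assms by (auto simp: PiE_def Pi_def intro: le_less_trans)
      ultimately show "a i = a' i" by simp
    qed
  qed
  then show ?thesis
    by (simp add: grid_box_def card_image card_PiE)
qed

lemma grid_boxE:
  assumes "u \<in> grid_box d m v r"
  obtains a where "u = grid_shift d m v a" "(\<Sum>i=1..d. a i) \<le> d * r"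
proof -
  obtain a where a: "u = grid_shift d m v a" "a \<in> PiE {1..d} (\<lambda>_. {..r})"
    using assms by (auto simp: grid_box_def)
  have "(\<Sum>i=1..d. a i) \<le> (\<Sum>i=1..d. r)"
    using a(2) by (intro sum_mono) auto
  with a(1) show thesis by (intro that) auto
qed

text \<open>Each coordinate of a point of the ball is within cyclic distance \<open>R\<close> of
  that of the centre, so the ball lies in a product of sets \<open>A i\<close> with at most
  \<open>2 * R + 1\<close> elements each.\<close>

lemma card_grid_ball:
  assumes "m \<ge> 1" and v: "v \<in> grid_vertices d m"
  shows "card {u \<in> grid_vertices d m. grid_dist d m u v \<le> int R} \<le> (2 * R + 1) ^ d"
proof -
  define A where "A = (\<lambda>i. {a. a < m \<and>
    min \<bar>int a - int (v i)\<bar> (int m - \<bar>int a - int (v i)\<bar>) \<le> int R})"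
  have fin: "finite (A i)" for i
    by (rule finite_subset[of _ "{..<m}"]) (auto simp: A_def)
  have "card (A i) \<le> 2 * R + 1" if i: "i \<in> {1..d}" for i
  proof -
    have "A i \<subseteq> (\<lambda>s. nat ((int (v i) + s) mod int m)) ` {- int R..int R}"
    proof
      fix a assume "a \<in> A i"
      then have a: "a < m" "\<bar>int a - int (v i)\<bar> \<le> int R \<or> int m - \<bar>int a - int (v i)\<bar> \<le> int R"
        by (auto simp: A_def min_def split: if_splits)
      note vi = grid_vertices_less[OF v i]
      have m0: "int a mod int m = int a" "(int a - int m) mod int m = int a"
          "(int a + int m) mod int m = int a"
        using a(1) by simp_all
      \<comment> \<open>The shift from \<open>v i\<close> to \<open>a\<close> is their difference,
        corrected by \<open>m\<close> downwards or upwards when the short way wraps around.\<close>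
      consider "\<bar>int a - int (v i)\<bar> \<le> int R"
        | "int m - \<bar>int a - int (v i)\<bar> \<le> int R" "int a \<ge> int (v i)"
        | "int m - \<bar>int a - int (v i)\<bar> \<le> int R" "int a < int (v i)"
        using a(2) by linarith
      then show "a \<in> (\<lambda>s. nat ((int (v i) + s) mod int m)) ` {- int R..int R}"
      proof cases
        case 1
        then show ?thesis
          using m0 by (intro image_eqI[of _ _ "int a - int (v i)"]) auto
      next
        case 2
        then show ?thesis
          using m0 a(1) vi by (intro image_eqI[of _ _ "int a - int m - int (v i)"]) auto
      next
        case 3
        then show ?thesis
          using m0 a(1) vi by (intro image_eqI[of _ _ "int a + int m - int (v i)"]) auto
      qed
    qed
    then have "card (A i) \<le> card {- int R..int R}"
      by (meson surj_card_le finite_atLeastAtMost_int)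
    then show ?thesis by simp
  qed
  moreover have "{u \<in> grid_vertices d m. grid_dist d m u v \<le> int R} \<subseteq> PiE {1..d} A"
  proof
    fix u assume u: "u \<in> {u \<in> grid_vertices d m. grid_dist d m u v \<le> int R}"
    have "u i \<in> A i" if i: "i \<in> {1..d}" for i
    proof -
      have "min \<bar>int (u i) - int (v i)\<bar> (int m - \<bar>int (u i) - int (v i)\<bar>) \<le> grid_dist d m u v"
        unfolding grid_dist_def
      proof (rule member_le_sum[OF i])
        fix j assume "j \<in> {1..d} - {i}"
        then show "0 \<le> min \<bar>int (u j) - int (v j)\<bar> (int m - \<bar>int (u j) - int (v j)\<bar>)"
          using grid_vertices_less[of u d m j] grid_vertices_less[OF v, of j] u by auto
      qed simp
      then show ?thesis
        using u grid_vertices_less[of u d m i] i by (auto simp: A_def)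
    qed
    then show "u \<in> PiE {1..d} A"
      using u by (auto simp: grid_vertices_def PiE_def)
  qed
  then have "card {u \<in> grid_vertices d m. grid_dist d m u v \<le> int R} \<le> card (PiE {1..d} A)"
    using fin by (intro card_mono finite_PiE) auto
  ultimately have "card {u \<in> grid_vertices d m. grid_dist d m u v \<le> int R} \<le> (\<Prod>i=1..d. 2 * R + 1)"
    by (metis (no_types, lifting) card_PiE finite_atLeastAtMost order_trans prod_mono zero_le)
  then show ?thesis by simp
qed

section \<open>Births against the maximum load of the grid\<close>

lemma grid_births_le_max_load:
  assumes m: "m \<ge> 1" and xb: "(x, b) \<in> set_pmf (loads_births (grid_vertices d m) (grid_edges d m) k)"
    and v: "v \<in> grid_vertices d m"
  defines "M \<equiv> max_load (grid_vertices d m) x"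
  shows "b v \<le> M * (2 * M + 1) ^ d"
proof -
  interpret search_graph "grid_vertices d m" "grid_edges d m" "grid_dist d m"
    by (rule search_graph_grid[OF m])
  have le: "x u \<le> M" if "u \<in> grid_vertices d m" for u
    using that unfolding M_def max_load_def by (intro Max_ge) (auto simp: finite_V)
  let ?B = "{u \<in> grid_vertices d m. grid_dist d m u v \<le> int M}"
  \<comment> \<open>All balls born at \<open>v\<close> end within distance \<open>M\<close>, where
    they share the capacity \<open>M\<close> of each vertex.\<close>
  have "sum b {v} \<le> sum x (nbhd_out M {v})"
    using v by (intro births_le_loads[OF xb] le) auto
  also have "nbhd_out M {v} = ?B"
    by (auto simp: nbhd_out_def grid_dist_commute)
  also have "sum x ?B \<le> card ?B * M"
    using sum_bounded_above[of ?B x M] le by auto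
  also have "\<dots> \<le> (2 * M + 1) ^ d * M"
    using card_grid_ball[OF m v] by (rule mult_right_mono) simp
  finally show ?thesis by (simp add: mult.commute)
qed

text \<open>When some vertex \<open>v\<close> first has load \<open>M\<close>, the Lipschitz
  property keeps all loads in a box at \<open>v\<close> at least \<open>M - d * r\<close>. The balls
  in the box were born within \<open>M\<close> of it, hence within
  \<open>M + d * r \<le> 2 * M\<close> of \<open>v\<close>.\<close>

lemma grid_load_needs_births:
  assumes m: "m \<ge> 2" and xb: "(x, b) \<in> set_pmf (loads_births (grid_vertices d m) (grid_edges d m) k)"
    and M: "M \<le> max_load (grid_vertices d m) x" and r: "r < m" "2 * (d * r) \<le> M"
  obtains v where "v \<in> grid_vertices d m"
    and "Suc r ^ d * (M - d * r) \<le> sum b {u \<in> grid_vertices d m. grid_dist d m u v \<le> int (2 * M)}"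
proof -
  have m1: "m \<ge> 1" using m by simp
  interpret search_graph "grid_vertices d m" "grid_edges d m" "grid_dist d m"
    by (rule search_graph_grid[OF m1])
  have "max_load (grid_vertices d m) x \<in> x ` grid_vertices d m"
    unfolding max_load_def using finite_V V_nonempty by (intro Max_in) auto
  then obtain v0 where "v0 \<in> grid_vertices d m" "M \<le> x v0"
    using M by auto
  \<comment> \<open>Stopping at the first time bounds the travel by \<open>M\<close> even if the
    final maximum load is much larger.\<close>
  from first_time_load[OF xb this] obtain y v where yv: "v \<in> grid_vertices d m" "y v = M"
      "lipschitz_loads (grid_edges d m) y"
      "\<forall>S\<subseteq>grid_vertices d m. sum y S \<le> sum b (nbhd_in M S)"
    by (elim exE conjE) (rule that)
  let ?Q = "grid_box d m v r"
  have "M - d * r \<le> y u" if "u \<in> ?Q" for u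
  proof -
    obtain a where a: "u = grid_shift d m v a" "(\<Sum>i=1..d. a i) \<le> d * r"
      using grid_boxE[OF \<open>u \<in> ?Q\<close>] .
    have "int (y v) \<le> int (y (grid_shift d m v a)) + int (\<Sum>i=1..d. a i)"
      using yv(3) by (intro grid_shift_lipschitz m yv(1)) (force simp: lipschitz_loads_def)
    also have "\<dots> \<le> int (y u) + int (d * r)"
      unfolding a(1) using a(2) by (intro add_left_mono) (simp only: of_nat_le_iff)
    finally show ?thesis
      using yv(2) by linarith
  qed
  then have "card ?Q * (M - d * r) \<le> sum y ?Q"
    using sum_bounded_below[of ?Q "M - d * r" y] by simp
  also have "\<dots> \<le> sum b (nbhd_in M ?Q)"
    using m by (intro yv(4)[rule_format]) (auto simp: grid_box_def grid_shift_in)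
  also have "\<dots> \<le> sum b {u \<in> grid_vertices d m. grid_dist d m u v \<le> int (2 * M)}"
  proof (intro sum_mono2)
    show "nbhd_in M ?Q \<subseteq> {u \<in> grid_vertices d m. grid_dist d m u v \<le> int (2 * M)}"
    proof
      fix w assume "w \<in> nbhd_in M ?Q"
      then obtain u where w: "w \<in> grid_vertices d m" "u \<in> ?Q" "grid_dist d m w u \<le> int M"
        by (auto simp: nbhd_in_def)
      obtain a where a: "u = grid_shift d m v a" "(\<Sum>i=1..d. a i) \<le> d * r"
        using grid_boxE[OF w(2)] .
      have "grid_dist d m w v \<le> grid_dist d m w u + grid_dist d m u v"
        using w(1) yv(1) a(1) m by (intro grid_dist_triangle) (auto simp: grid_shift_in)
      moreover have "grid_dist d m u v \<le> int (d * r)"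
        unfolding a(1) using grid_dist_shift[OF m yv(1), of a] a(2)
        by (meson of_nat_le_iff order_trans)
      moreover have "int (d * r) \<le> int M"
        unfolding of_nat_le_iff using r(2) by linarith
      ultimately show "w \<in> {u \<in> grid_vertices d m. grid_dist d m u v \<le> int (2 * M)}"
        using w(1,3) r(2) by simp
    qed
  qed (auto simp: finite_V)
  finally show thesis
    using that[OF yv(1)] card_grid_box[OF r(1)] by simp
qed

section \<open>Birth counts\<close>

context
  fixes V :: "'v set"
  assumes V: "finite V" "V \<noteq> {}"
begin

lemma finite_set_births: "finite (set_pmf (births V k))"
  by (induction k) (auto simp: V)

lemma integrable_births: "integrable (measure_pmf (births V k)) (f :: _ \<Rightarrow> real)"
  by (rule integrable_measure_pmf_finite[OF finite_set_births])

lemma expectation_births_Suc: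
  fixes f :: "('v \<Rightarrow> nat) \<Rightarrow> real"
  shows "measure_pmf.expectation (births V (Suc k)) f =
    measure_pmf.expectation (births V k)
      (\<lambda>b. (\<Sum>u\<in>V. f (b(u := Suc (b u)))) / real (card V))"
proof -
  have "measure_pmf.expectation (births V (Suc k)) f =
      (\<Sum>b\<in>set_pmf (births V k). pmf (births V k) b *
        measure_pmf.expectation (pmf_of_set V \<bind> (\<lambda>u. return_pmf (b(u := b u + 1)))) f)"
    unfolding births.simps
    by (subst pmf_expectation_bind[OF finite_set_births]) (auto simp: V)
  also have "\<dots> = (\<Sum>b\<in>set_pmf (births V k). pmf (births V k) b *
        ((\<Sum>u\<in>V. f (b(u := Suc (b u)))) / real (card V)))"
    by (simp add: pmf_expectation_bind_pmf_of_set[OF V(2,1)] sum_divide_distrib divide_inverse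
        mult.commute sum_distrib_left)
  also have "\<dots> = measure_pmf.expectation (births V k)
      (\<lambda>b. (\<Sum>u\<in>V. f (b(u := Suc (b u)))) / real (card V))"
    by (subst integral_measure_pmf[OF finite_set_births]) (auto simp: mult.commute)
  finally show ?thesis .
qed

text \<open>The sum over \<open>S\<close> depends on the new birthplace only through its membership
  in \<open>S\<close>.\<close>

lemma sum_over_birth_in:
  fixes g :: "nat \<Rightarrow> real"
  assumes "S \<subseteq> V"
  shows "(\<Sum>u\<in>V. g (sum (b(u := Suc (b u))) S)) =
    real (card S) * g (Suc (sum b S)) + (real (card V) - real (card S)) * g (sum b S)"
proof -
  have finS: "finite S" using assms V(1) finite_subset by auto
  have "(\<Sum>u\<in>V. g (sum (b(u := Suc (b u))) S)) =
      (\<Sum>u\<in>S. g (sum (b(u := Suc (b u))) S)) + (\<Sum>u\<in>V - S. g (sum (b(u := Suc (b u))) S))"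
    using sum.subset_diff[OF assms V(1)] by (simp add: add.commute)
  also have "(\<Sum>u\<in>S. g (sum (b(u := Suc (b u))) S)) = (\<Sum>u\<in>S. g (Suc (sum b S)))"
    unfolding sum_fun_upd_Suc[OF finS] by (intro sum.cong) auto
  also have "(\<Sum>u\<in>V - S. g (sum (b(u := Suc (b u))) S)) = (\<Sum>u\<in>V - S. g (sum b S))"
    unfolding sum_fun_upd_Suc[OF finS] by (intro sum.cong) auto
  finally show ?thesis
    using card_mono[OF V(1) assms] by (simp add: card_Diff_subset[OF finS assms] of_nat_diff)
qed

text \<open>The number of births in \<open>S\<close> is binomial with \<open>k\<close> trials and
  success probability \<open>card S / card V\<close>; this is its generating function at
  \<open>z\<close>.\<close>

lemma births_mgf:
  fixes z :: real
  assumes "S \<subseteq> V"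
  shows "measure_pmf.expectation (births V k) (\<lambda>b. z ^ sum b S) =
    (1 + (z - 1) * real (card S) / real (card V)) ^ k"
proof (induction k)
  case (Suc k)
  have n: "real (card V) > 0"
    using V by (simp add: card_gt_0_iff)
  have "measure_pmf.expectation (births V (Suc k)) (\<lambda>b. z ^ sum b S) =
      measure_pmf.expectation (births V k)
        (\<lambda>b. z ^ sum b S * (1 + (z - 1) * real (card S) / real (card V)))"
    unfolding expectation_births_Suc sum_over_birth_in[OF assms]
    using n by (intro Bochner_Integration.integral_cong) (auto simp: field_simps)
  then show ?case
    using Suc by simp
qed simp

text \<open>Markov's inequality for \<open>z ^ sum b S\<close>, with
  \<open>1 + q \<le> exp q\<close>. As there are \<open>card V\<close> balls, the mean number of
  births in \<open>S\<close> is \<open>card S\<close>.\<close>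

lemma births_chernoff:
  fixes z :: real
  assumes "S \<subseteq> V" "z \<ge> 1"
  shows "measure_pmf.prob (births V (card V)) {b. K \<le> sum b S} \<le> exp (z * real (card S)) / z ^ K"
proof -
  have n: "real (card V) > 0"
    using V by (simp add: card_gt_0_iff)
  let ?p = "births V (card V)" and ?q = "(z - 1) * real (card S) / real (card V)"
  have "measure_pmf.prob ?p {b. K \<le> sum b S} \<le> measure_pmf.prob ?p {b. z ^ K \<le> z ^ sum b S}"
    using assms(2) by (intro measure_pmf.finite_measure_mono) (auto intro: power_increasing)
  also have "\<dots> \<le> measure_pmf.expectation ?p (\<lambda>b. z ^ sum b S) / z ^ K"
    using integral_Markov_inequality_measure[OF integrable_births, of UNIV "card V" "\<lambda>b. z ^ sum b S" "z ^ K"]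
      assms(2) by simp
  also have "\<dots> \<le> exp (z * real (card S)) / z ^ K"
  proof (rule divide_right_mono)
    have "(1 + ?q) ^ card V \<le> exp ?q ^ card V"
      using assms(2) n by (intro power_mono exp_ge_add_one_self add_nonneg_nonneg) auto
    also have "\<dots> = exp ((z - 1) * real (card S))"
      using n by (simp add: exp_of_nat_mult[symmetric])
    also have "\<dots> \<le> exp (z * real (card S))"
      by (simp add: left_diff_distrib)
    finally show "measure_pmf.expectation ?p (\<lambda>b. z ^ sum b S) \<le> exp (z * real (card S))"
      by (simp add: births_mgf[OF assms(1)])
  qed (use assms(2) in auto)
  finally show ?thesis .
qed

section \<open>Second moment of the number of vertices with \<open>k\<close> births\<close>

definition inv_card :: real where "inv_card = 1 / real (card V)"

text \<open>The binomial point probability with success probability \<open>inv_card\<close>,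
  arranged so that no exponent \<open>t - i\<close> occurs; the induction is Pascal's rule.\<close>

lemma prob_births_eq:
  assumes "v \<in> V" "card V \<ge> 2"
  shows "measure_pmf.expectation (births V t) (\<lambda>b. of_bool (b v = i)) =
    (1 - inv_card) ^ t * real (t choose i) * (inv_card / (1 - inv_card)) ^ i"
    (is "?P t i = ?h t i")
proof (induction t arbitrary: i)
  case 0
  show ?case by (cases i) auto
next
  case (Suc t)
  have n: "real (card V) > 1"
    using assms(2) by simp
  have p: "1 - inv_card > 0"
    using n by (simp add: inv_card_def)
  have step: "(\<Sum>u\<in>V. of_bool ((b(u := Suc (b u))) v = i)) / real (card V) =
      inv_card * of_bool (Suc (b v) = i) + (1 - inv_card) * of_bool (b v = i)" for b i
    using sum_over_birth_in[of "{v}" "\<lambda>j. of_bool (j = i)" b] assms(1) n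
    by (simp add: inv_card_def field_simps)
  have rec: "?P (Suc t) i = inv_card * measure_pmf.expectation (births V t) (\<lambda>b. of_bool (Suc (b v) = i))
      + (1 - inv_card) * ?P t i"
    unfolding expectation_births_Suc step
    by (simp add: Bochner_Integration.integral_add integrable_births)
  show ?case
  proof (cases i)
    case 0
    then show ?thesis
      unfolding rec Suc by simp
  next
    case (Suc j)
    have "?P (Suc t) i = inv_card * ?P t j + (1 - inv_card) * ?P t i"
      unfolding rec by (simp add: Suc)
    also have "\<dots> = ?h (Suc t) i"
      unfolding Suc.IH using p by (simp add: Suc field_simps)
    finally show ?thesis .
  qed
qed

text \<open>The factor \<open>(1 - inv_card)\<close> is squared in the denominator so that both sides obey the
  same recursion up to the inequality \<open>1 - 2 p \<le> (1 - p)\<^sup>2\<close>.\<close>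

lemma prob_births_pair_le:
  assumes "v \<in> V" "w \<in> V" "v \<noteq> w"
  shows "measure_pmf.expectation (births V t) (\<lambda>b. of_bool (b v = i \<and> b w = j)) \<le>
    ((1 - inv_card) ^ t * real (t choose i) * (inv_card / (1 - inv_card)\<^sup>2) ^ i) *
    ((1 - inv_card) ^ t * real (t choose j) * (inv_card / (1 - inv_card)\<^sup>2) ^ j)"
    (is "?P t i j \<le> ?g t i * ?g t j")
proof (induction t arbitrary: i j)
  case 0
  show ?case by (cases i; cases j) auto
next
  case (Suc t)
  define p where "p = inv_card"
  have "card {v, w} \<le> card V"
    using assms V(1) by (intro card_mono) auto
  then have n: "real (card V) \<ge> 2"
    using assms(3) by simp
  have p: "0 < p" "0 \<le> 1 - 2 * p" "0 < 1 - p"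
    using n by (simp_all add: inv_card_def p_def)
  \<comment> \<open>The last ball is born at \<open>v\<close>, at \<open>w\<close> or
    elsewhere.\<close>
  have step: "(\<Sum>u\<in>V. of_bool ((b(u := Suc (b u))) v = i \<and> (b(u := Suc (b u))) w = j)) / real (card V) =
      p * of_bool (Suc (b v) = i \<and> b w = j) + p * of_bool (b v = i \<and> Suc (b w) = j)
      + (1 - 2 * p) * of_bool (b v = i \<and> b w = j)" (is "?S / _ = _") for b i j
  proof -
    have "?S = of_bool (Suc (b v) = i \<and> b w = j) + (of_bool (b v = i \<and> Suc (b w) = j)
        + (\<Sum>u\<in>V - {v} - {w}. of_bool ((b(u := Suc (b u))) v = i \<and> (b(u := Suc (b u))) w = j)))"
      using assms V(1) by (subst sum.remove[of _ v]; (subst sum.remove[of _ w])?) auto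
    also have "(\<Sum>u\<in>V - {v} - {w}. of_bool ((b(u := Suc (b u))) v = i \<and> (b(u := Suc (b u))) w = j)) =
        (\<Sum>u\<in>V - {v} - {w}. of_bool (b v = i \<and> b w = j))"
      by (intro sum.cong) auto
    also have "\<dots> = (real (card V) - 2) * of_bool (b v = i \<and> b w = j)"
      using assms V(1) n by (simp add: of_nat_diff)
    finally have S: "?S = of_bool (Suc (b v) = i \<and> b w = j) + (of_bool (b v = i \<and> Suc (b w) = j)
        + (real (card V) - 2) * of_bool (b v = i \<and> b w = j))" .
    have "(x + (y + (real (card V) - 2) * z)) / real (card V) = p * x + p * y + (1 - 2 * p) * z"
      for x y z :: real
      using n by (simp add: p_def inv_card_def field_simps)
    then show ?thesis
      unfolding S .
  qed
  have rec: "?P (Suc t) i j =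
      p * measure_pmf.expectation (births V t) (\<lambda>b. of_bool (Suc (b v) = i \<and> b w = j))
      + p * measure_pmf.expectation (births V t) (\<lambda>b. of_bool (b v = i \<and> Suc (b w) = j))
      + (1 - 2 * p) * ?P t i j"
    unfolding expectation_births_Suc step
    by (simp add: Bochner_Integration.integral_add integrable_births)
  define r where "r = p / (1 - p)\<^sup>2"
  define g where "g = (\<lambda>t i. (1 - p) ^ t * real (t choose i) * r ^ i)"
  have r: "r \<ge> 0" "(1 - p)\<^sup>2 * r = p"
    using p by (auto simp: r_def)
  have g0: "g t i \<ge> 0" for t i
    using p r by (auto simp: g_def)
  have g_0: "g (Suc t) 0 = (1 - p) * g t 0" for t
    by (simp add: g_def)
  have g_Suc: "g (Suc t) (Suc i) = (1 - p) * (g t (Suc i) + r * g t i)" for t i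
    by (simp add: g_def algebra_simps)
  have a2: "1 - 2 * p \<le> (1 - p)\<^sup>2"
    by (simp add: power2_eq_square algebra_simps)
  have IH: "?P t i j \<le> g t i * g t j" for i j
    using Suc[of i j] unfolding g_def r_def p_def .
  have last: "(1 - 2 * p) * ?P t i j \<le> (1 - p)\<^sup>2 * (g t i * g t j)" for i j
    using IH[of i j] a2 p g0[of t i] g0[of t j] by (intro mult_mono) auto
  have "?P (Suc t) i j \<le> g (Suc t) i * g (Suc t) j"
  proof (cases i; cases j)
    assume i: "i = 0" and j: "j = 0"
    show ?thesis
      unfolding rec using last[of i j] by (simp add: i j g_0 power2_eq_square algebra_simps)
  next
    fix j' assume i: "i = 0" and j: "j = Suc j'"
    have "?P (Suc t) i j = p * ?P t i j' + (1 - 2 * p) * ?P t i j"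
      unfolding rec by (simp add: i j)
    also have "\<dots> \<le> p * (g t i * g t j') + (1 - p)\<^sup>2 * (g t i * g t j)"
      using p by (intro add_mono last mult_left_mono IH) auto
    also have "\<dots> = (1 - p)\<^sup>2 * (g t i * (g t j + r * g t j'))"
      by (subst (1) r(2)[symmetric]) (simp add: algebra_simps)
    also have "\<dots> = g (Suc t) i * g (Suc t) j"
      by (simp add: i j g_0 g_Suc power2_eq_square)
    finally show ?thesis .
  next
    fix i' assume i: "i = Suc i'" and j: "j = 0"
    have "?P (Suc t) i j = p * ?P t i' j + (1 - 2 * p) * ?P t i j"
      unfolding rec by (simp add: i j)
    also have "\<dots> \<le> p * (g t i' * g t j) + (1 - p)\<^sup>2 * (g t i * g t j)"
      using p by (intro add_mono last mult_left_mono IH) auto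
    also have "\<dots> = (1 - p)\<^sup>2 * ((g t i + r * g t i') * g t j)"
      by (subst (1) r(2)[symmetric]) (simp add: algebra_simps)
    also have "\<dots> = g (Suc t) i * g (Suc t) j"
      by (simp add: i j g_0 g_Suc power2_eq_square)
    finally show ?thesis .
  next
    fix i' j' assume i: "i = Suc i'" and j: "j = Suc j'"
    have "?P (Suc t) i j = p * ?P t i' j + p * ?P t i j' + (1 - 2 * p) * ?P t i j"
      unfolding rec by (simp add: i j)
    also have "\<dots> \<le> p * (g t i' * g t j) + p * (g t i * g t j') + (1 - p)\<^sup>2 * (g t i * g t j)"
      using p by (intro add_mono last mult_left_mono IH) auto
    also have "\<dots> = (1 - p)\<^sup>2 * (r * g t i' * g t j + g t i * (r * g t j') + g t i * g t j)"
      by (subst (1 2) r(2)[symmetric]) (simp add: algebra_simps)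
    \<comment> \<open>The product on the right has one more, nonnegative term: a single ball cannot
      be born at both vertices, but independent counts would allow it.\<close>
    also have "\<dots> \<le> (1 - p)\<^sup>2 * ((g t i + r * g t i') * (g t j + r * g t j'))"
      using r(1) g0[of t i'] g0[of t j'] by (intro mult_left_mono) (auto simp: algebra_simps)
    also have "\<dots> = g (Suc t) i * g (Suc t) j"
      by (simp add: i j g_Suc power2_eq_square)
    finally show ?thesis .
  qed
  then show ?case
    unfolding g_def r_def p_def .
qed

text \<open>Chebyshev's inequality for the number \<open>Z\<close> of vertices with exactly
  \<open>k\<close> births, whose mean is \<open>\<mu>\<close>. The pair bound makes its second
  moment at most \<open>\<mu>\<close> plus a near-one multiple of the squared mean when
  \<open>k\<close> is small against \<open>card V\<close>.\<close>

lemma prob_no_births_eq_le: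
  fixes t k :: nat
  assumes n: "card V \<ge> 2"
  defines "\<mu> \<equiv> real (card V) * ((1 - inv_card) ^ t * real (t choose k) * (inv_card / (1 - inv_card)) ^ k)"
  assumes \<mu>: "\<mu> > 0"
  shows "measure_pmf.prob (births V t) {b. \<forall>v\<in>V. b v \<noteq> k} \<le>
    1 / \<mu> + 1 / (1 - inv_card) ^ (2 * k) - 1"
proof -
  define a where "a = 1 - inv_card"
  have a: "a > 0" using n by (simp add: a_def inv_card_def)
  define h where "h = a ^ t * real (t choose k) * (inv_card / a) ^ k"
  have \<mu>h: "\<mu> = real (card V) * h"
    by (simp add: \<mu>_def h_def a_def)
  have h: "h > 0" using \<mu> n by (simp add: \<mu>h zero_less_mult_iff)
  let ?E = "measure_pmf.expectation (births V t) :: _ \<Rightarrow> real"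
  define Z where "Z = (\<lambda>b. \<Sum>v\<in>V. of_bool (b v = k) :: real)"
  have EZ: "?E Z = \<mu>"
    unfolding Z_def
    by (subst Bochner_Integration.integral_sum[OF integrable_births])
      (simp add: prob_births_eq[OF _ n] \<mu>_def)
  \<comment> \<open>The extra \<open>h\<close> is the diagonal contribution. Off the diagonal,
    squaring the denominator in the pair bound costs the factor \<open>1 / a ^ k\<close> for each
    vertex.\<close>
  have pair: "?E (\<lambda>b. of_bool (b v = k) * of_bool (b w = k)) \<le> (h / a ^ k)\<^sup>2 + (if v = w then h else 0)"
    if "v \<in> V" "w \<in> V" for v w
  proof (cases "v = w")
    case True
    have "?E (\<lambda>b. of_bool (b v = k) * of_bool (b w = k)) = ?E (\<lambda>b. of_bool (b v = k))"
      using True by (intro Bochner_Integration.integral_cong) auto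
    also have "\<dots> = h"
      by (simp add: prob_births_eq[OF that(1) n] h_def a_def)
    finally show ?thesis using True by simp
  next
    case False
    have "?E (\<lambda>b. of_bool (b v = k) * of_bool (b w = k)) = ?E (\<lambda>b. of_bool (b v = k \<and> b w = k))"
      by (intro Bochner_Integration.integral_cong) auto
    also have "\<dots> \<le> (a ^ t * real (t choose k) * (inv_card / a\<^sup>2) ^ k)\<^sup>2"
      by (rule order_trans[OF prob_births_pair_le[OF that False]])
        (simp add: a_def power2_eq_square)
    also have "a ^ t * real (t choose k) * (inv_card / a\<^sup>2) ^ k = h / a ^ k"
      using a by (simp add: h_def power_divide power2_eq_square power_mult_distrib)
    finally show ?thesis using False by simp
  qed
  have "?E (\<lambda>b. (Z b)\<^sup>2) = (\<Sum>v\<in>V. \<Sum>w\<in>V. ?E (\<lambda>b. of_bool (b v = k) * of_bool (b w = k)))"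
    by (simp add: Z_def power2_eq_square sum_product Bochner_Integration.integral_sum integrable_births)
  also have "\<dots> \<le> (\<Sum>v\<in>V. \<Sum>w\<in>V. (h / a ^ k)\<^sup>2 + (if v = w then h else 0))"
    by (intro sum_mono pair)
  also have "\<dots> = \<mu>\<^sup>2 / a ^ (2 * k) + \<mu>"
    using V(1) by (simp add: sum.distrib sum.delta \<mu>h power_divide power_mult[symmetric]
        mult.commute[of k] power_mult_distrib power2_eq_square[of "real (card V)"] distrib_left)
  finally have EZ2: "?E (\<lambda>b. (Z b)\<^sup>2) \<le> \<mu>\<^sup>2 / a ^ (2 * k) + \<mu>" .
  have var: "?E (\<lambda>b. (Z b - \<mu>)\<^sup>2) = ?E (\<lambda>b. (Z b)\<^sup>2) - \<mu>\<^sup>2"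
  proof -
    have "?E (\<lambda>b. (Z b - \<mu>)\<^sup>2) = ?E (\<lambda>b. (Z b)\<^sup>2 - (2 * \<mu>) * Z b + \<mu>\<^sup>2)"
      by (intro Bochner_Integration.integral_cong) (auto simp: power2_eq_square algebra_simps)
    also have "\<dots> = ?E (\<lambda>b. (Z b)\<^sup>2) - (2 * \<mu>) * ?E Z + \<mu>\<^sup>2"
      by (simp add: Bochner_Integration.integral_add Bochner_Integration.integral_diff integrable_births)
    finally show ?thesis
      by (simp add: EZ power2_eq_square)
  qed
  \<comment> \<open>If no vertex has \<open>k\<close> births, then \<open>Z\<close> is 0 and
    deviates from its mean by exactly \<open>\<mu>\<close>.\<close>
  have "measure_pmf.prob (births V t) {b. \<forall>v\<in>V. b v \<noteq> k} \<le>
      measure_pmf.prob (births V t) {b. \<mu>\<^sup>2 \<le> (Z b - \<mu>)\<^sup>2}"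
    by (intro measure_pmf.finite_measure_mono) (auto simp: Z_def)
  also have "\<dots> \<le> ?E (\<lambda>b. (Z b - \<mu>)\<^sup>2) / \<mu>\<^sup>2"
    using integral_Markov_inequality_measure[OF integrable_births, of UNIV t "\<lambda>b. (Z b - \<mu>)\<^sup>2" "\<mu>\<^sup>2"] \<mu>
    by simp
  also have "\<dots> \<le> (\<mu>\<^sup>2 / a ^ (2 * k) + \<mu> - \<mu>\<^sup>2) / \<mu>\<^sup>2"
    unfolding var using EZ2 by (intro divide_right_mono) auto
  also have "\<dots> = 1 / \<mu> + 1 / a ^ (2 * k) - 1"
    using \<mu> a by (simp add: field_simps power2_eq_square)
  finally show ?thesis
    by (simp add: a_def)
qed

end

section \<open>Maximum load of the grid\<close>

text \<open>The argument is the number of vertices, taken as a real so that asymptotics can be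
  proved for real \<open>x\<close> and then composed with \<open>m ^ d\<close>.\<close>

definition load_scale :: "nat \<Rightarrow> real \<Rightarrow> real" where
  "load_scale d x = (ln x / ln (ln x)) powr (1 / (real d + 1))"

lemma load_scale_power:
  assumes "0 \<le> ln x / ln (ln x)"
  shows "load_scale d x ^ (d + 1) = ln x / ln (ln x)"
proof -
  have "(q powr (1 / (real d + 1))) ^ (d + 1) = q" if "0 \<le> q" for q :: real
  proof (cases "q = 0")
    case False
    have "real (d + 1) * (1 / (real d + 1)) = 1"
      by simp
    with False that show ?thesis
      by (subst powr_power) (auto simp: add.commute)
  qed simp
  then show ?thesis
    using assms unfolding load_scale_def .
qed

lemma filterlim_real_power_at_top:
  assumes "d \<ge> 1"
  shows "filterlim (\<lambda>m. real (m ^ d)) at_top sequentially"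
proof (rule filterlim_at_top_mono[OF filterlim_real_sequentially])
  show "\<forall>\<^sub>F m in sequentially. real m \<le> real (m ^ d)"
    using eventually_ge_at_top[of 1]
    by eventually_elim (metis assms of_nat_mono power_increasing power_one_right)
qed

lemma prob_loads_le_births:
  assumes "\<And>x b. (x, b) \<in> set_pmf (loads_births V E k) \<Longrightarrow> x \<in> A \<Longrightarrow> b \<in> B"
  shows "measure_pmf.prob (loads V E k) A \<le> measure_pmf.prob (births V k) B"
proof -
  have "measure_pmf.prob (loads_births V E k) (fst -` A) \<le>
      measure_pmf.prob (loads_births V E k) (snd -` B)"
    using assms by (intro measure_pmf.finite_measure_mono_AE) (auto simp: AE_measure_pmf_iff)
  then show ?thesis
    by (simp only: map_fst_loads_births[symmetric] map_snd_loads_births[of V E k, symmetric] measure_map_pmf)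
qed

section \<open>Upper tail of the maximum load\<close>

lemma prob_max_load_ge:
  assumes d: "d \<ge> 1" and m: "m \<ge> 2" and M: "1 \<le> M" "M \<le> m"
  defines "\<kappa> \<equiv> 1 / (2 * (2 * real d) ^ d)"
  shows "measure_pmf.prob (loads (grid_vertices d m) (grid_edges d m) (m ^ d))
      {x. M \<le> max_load (grid_vertices d m) x} \<le>
    real (m ^ d) * exp (5 ^ d * real M ^ d * sqrt (real M) - \<kappa> * real M ^ (d + 1) * ln (real M) / 2)"
proof -
  let ?V = "grid_vertices d m"
  \<comment> \<open>The largest \<open>r\<close> with \<open>2 * d * r \<le> M\<close>: loads in the
    box stay at least \<open>M / 2\<close>, while its side \<open>Suc r\<close> exceeds
    \<open>M / (2 * d)\<close>. These two facts yield \<open>\<kappa>\<close>.\<close>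
  define r where "r = M div (2 * d)"
  define K where "K = Suc r ^ d * (M - d * r)"
  define B where "B = (\<lambda>v. {u \<in> ?V. grid_dist d m u v \<le> int (2 * M)})"
  have r: "2 * (d * r) \<le> M" "r < m"
  proof -
    show 1: "2 * (d * r) \<le> M"
      by (metis r_def mult.assoc times_div_less_eq_dividend)
    have "r * 2 \<le> 2 * (d * r)" using d by simp
    then show "r < m" using 1 M by linarith
  qed
  have V: "finite ?V" "?V \<noteq> {}"
    using search_graph.finite_V[OF search_graph_grid] search_graph.V_nonempty[OF search_graph_grid] m
    by auto
  \<comment> \<open>This Chernoff parameter gains \<open>ln M / 2\<close> per birth, while its cost,
    of order \<open>M ^ d * sqrt M\<close>, is of lower order than
    \<open>M ^ (d + 1)\<close>.\<close>
  have z: "sqrt (real M) \<ge> 1" using M by simp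
  have Kge: "\<kappa> * real M ^ (d + 1) \<le> real K"
  proof -
    have "M < 2 * d * Suc r"
      unfolding r_def using d by (metis dividend_less_times_div mult_Suc_right mult_pos_pos
          pos2 less_le_trans zero_less_one)
    then have "real M < real (2 * d * Suc r)"
      by (simp only: of_nat_less_iff)
    then have 1: "real M / (2 * real d) \<le> real (Suc r)"
      using d by (simp add: field_simps)
    have "real (2 * (d * r)) \<le> real M"
      using r(1) by (simp only: of_nat_le_iff)
    then have 2: "real M / 2 \<le> real (M - d * r)"
      using r(1) by (subst of_nat_diff) auto
    have "\<kappa> * real M ^ (d + 1) = (real M / (2 * real d)) ^ d * (real M / 2)"
      by (simp add: \<kappa>_def power_divide power_mult_distrib mult.commute)
    also have "\<dots> \<le> real (Suc r) ^ d * real (M - d * r)"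
      using d by (intro mult_mono power_mono 1 2) auto
    finally show ?thesis
      by (simp add: K_def del: of_nat_Suc)
  qed
  \<comment> \<open>The centre depends on the configuration, hence the union over all
    \<open>v\<close>.\<close>
  have "measure_pmf.prob (loads ?V (grid_edges d m) (m ^ d)) {x. M \<le> max_load ?V x} \<le>
      measure_pmf.prob (births ?V (m ^ d)) (\<Union>v\<in>?V. {b. K \<le> sum b (B v)})"
  proof (rule prob_loads_le_births)
    fix x b assume xb: "(x, b) \<in> set_pmf (loads_births ?V (grid_edges d m) (m ^ d))"
      and x: "x \<in> {x. M \<le> max_load ?V x}"
    from x have "M \<le> max_load ?V x" by simp
    from grid_load_needs_births[OF m xb this r(2,1)] obtain v where "v \<in> ?V" "K \<le> sum b (B v)"
      unfolding K_def B_def by blast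
    then show "b \<in> (\<Union>v\<in>?V. {b. K \<le> sum b (B v)})" by blast
  qed
  also have "\<dots> \<le> (\<Sum>v\<in>?V. measure_pmf.prob (births ?V (m ^ d)) {b. K \<le> sum b (B v)})"
    using V by (intro measure_pmf.finite_measure_subadditive_finite) auto
  also have "\<dots> \<le> (\<Sum>v\<in>?V. exp (5 ^ d * real M ^ d * sqrt (real M) - \<kappa> * real M ^ (d + 1) * ln (real M) / 2))"
  proof (rule sum_mono)
    fix v assume v: "v \<in> ?V"
    have "card (B v) \<le> (2 * (2 * M) + 1) ^ d"
      unfolding B_def using m v by (intro card_grid_ball) auto
    also have "\<dots> \<le> (5 * M) ^ d"
      using M by (intro power_mono) auto
    finally have "real (card (B v)) \<le> real ((5 * M) ^ d)"
      by (simp only: of_nat_le_iff)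
    then have card: "real (card (B v)) \<le> 5 ^ d * real M ^ d"
      by (simp add: power_mult_distrib)
    have "measure_pmf.prob (births ?V (m ^ d)) {b. K \<le> sum b (B v)} \<le>
        exp (sqrt (real M) * real (card (B v))) / sqrt (real M) ^ K"
      using births_chernoff[OF V _ z, of "B v" K] by (auto simp: B_def card_grid_vertices)
    also have "sqrt (real M) ^ K = exp (real K * (ln (real M) / 2))"
      using M by (simp add: exp_of_nat_mult ln_sqrt[symmetric])
    also have "exp (sqrt (real M) * real (card (B v))) / exp (real K * (ln (real M) / 2)) =
        exp (sqrt (real M) * real (card (B v)) - real K * (ln (real M) / 2))"
      by (simp add: exp_diff)
    also have "\<dots> \<le> exp (sqrt (real M) * (5 ^ d * real M ^ d) - \<kappa> * real M ^ (d + 1) * (ln (real M) / 2))"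
      unfolding exp_le_cancel_iff using M
      by (intro diff_mono mult_left_mono mult_right_mono card Kge) auto
    finally show "measure_pmf.prob (births ?V (m ^ d)) {b. K \<le> sum b (B v)} \<le>
        exp (5 ^ d * real M ^ d * sqrt (real M) - \<kappa> * real M ^ (d + 1) * ln (real M) / 2)"
      by (simp add: mult.commute)
  qed
  finally show ?thesis
    by (simp add: card_grid_vertices)
qed

text \<open>With \<open>p = 1 / d\<close> the right-hand side is the side length of the grid, so the
  level \<open>M\<close> below fits into it; the added one covers rounding.\<close>

lemma load_scale_le_powr:
  fixes C p :: real
  assumes "C > 0" "p > 0"
  shows "\<forall>\<^sub>F x in at_top. C * load_scale d x + 1 \<le> x powr p"
proof -
  have "1 / (real d + 1) > 0" by simp
  with assms show ?thesis
    unfolding load_scale_def by real_asymp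
qed

text \<open>The logarithm of the scale is \<open>ln (ln x) - ln (ln (ln x))\<close> over
  \<open>d + 1\<close>; giving up half of \<open>ln (ln x)\<close> absorbs the triple
  logarithm.\<close>

lemma ln_load_scale_ge: "\<forall>\<^sub>F x in at_top. ln (ln x) / (2 * (real d + 1)) \<le> ln (load_scale d x)"
proof -
  have "\<forall>\<^sub>F x::real in at_top. ln (ln x) / 2 \<le> ln (ln x / ln (ln x))"
    by real_asymp
  moreover have "\<forall>\<^sub>F x::real in at_top. 0 < ln x / ln (ln x)"
    by real_asymp
  ultimately show ?thesis
  proof eventually_elim
    case (elim x)
    have "ln (load_scale d x) = ln (ln x / ln (ln x)) / (real d + 1)"
      using elim by (simp add: load_scale_def ln_powr)
    then show ?case
      using divide_right_mono[OF elim(1), of "real d + 1"] by simp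
  qed
qed

text \<open>At the first integer above \<open>C\<close> times the scale, the exponent is at most
  \<open>- 2 * ln x\<close>, which beats the \<open>x\<close> choices of the centre and leaves
  \<open>1 / x\<close>.\<close>

lemma max_load_upper:
  assumes d: "d \<ge> 1"
  obtains C where "C \<ge> 1"
    and "(\<lambda>m. measure_pmf.prob (loads (grid_vertices d m) (grid_edges d m) (m ^ d))
      {x. C * load_scale d (real (m ^ d)) < real (max_load (grid_vertices d m) x)}) \<longlonglongrightarrow> 0"
proof -
  define \<kappa> where "\<kappa> = 1 / (2 * (2 * real d) ^ d)"
  have \<kappa>: "0 < \<kappa>" "\<kappa> \<le> 1"
  proof -
    show "0 < \<kappa>" using d by (simp add: \<kappa>_def)
    have "1 \<le> (2 * real d) ^ d" using d by (intro one_le_power) simp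
    then show "\<kappa> \<le> 1" by (simp add: \<kappa>_def field_simps)
  qed
  \<comment> \<open>Chosen so that \<open>\<kappa> / 4 * C / (2 * (d + 1)) = 2\<close>.\<close>
  define C where "C = 16 * (real d + 1) / \<kappa>"
  have C: "C \<ge> 1"
    using \<kappa> d by (simp add: C_def field_simps)
  let ?r = "load_scale d"
  define P where "P = (\<lambda>m. measure_pmf.prob (loads (grid_vertices d m) (grid_edges d m) (m ^ d))
      {x. C * ?r (real (m ^ d)) < real (max_load (grid_vertices d m) x)})"
  note lim = filterlim_real_power_at_top[OF d]
  have p: "1 / real d > 0" and C0: "C > 0"
    using d C by simp_all
  \<comment> \<open>The exponential moment may use up half of the gain
    \<open>\<kappa> / 2 * ln y\<close>, which leaves \<open>\<kappa> / 4\<close>.\<close>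
  have dominate: "\<forall>\<^sub>F y::real in at_top. 5 ^ d / sqrt y \<le> \<kappa> / 4 * ln y"
  proof -
    have "(5::real) ^ d > 0" by simp
    with \<kappa>(1) show ?thesis by real_asymp
  qed
  then obtain y0 where y0: "\<And>y. y \<ge> y0 \<Longrightarrow> 5 ^ d / sqrt y \<le> \<kappa> / 4 * ln y"
    by (auto simp: eventually_at_top_linorder)
  have r_large: "\<forall>\<^sub>F x in at_top. ?r x \<ge> max 1 y0"
  proof -
    have "1 / (real d + 1) > 0" by simp
    then have "filterlim ?r at_top at_top"
      unfolding load_scale_def by real_asymp
    then show ?thesis unfolding filterlim_at_top by blast
  qed
  have pos: "\<forall>\<^sub>F x::real in at_top. 0 < ln x \<and> 0 < ln (ln x)"
    by (intro eventually_conj; real_asymp)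
  have "\<forall>\<^sub>F m in sequentially. P m \<le> 1 / real (m ^ d)"
    using eventually_compose_filterlim[OF load_scale_le_powr[OF C0 p, of d] lim]
      eventually_compose_filterlim[OF ln_load_scale_ge[of d] lim]
      eventually_compose_filterlim[OF r_large lim] eventually_compose_filterlim[OF pos lim]
      eventually_ge_at_top[of 2]
  proof eventually_elim
    case (elim m)
    define x where "x = real (m ^ d)"
    note elim = elim[folded x_def]
    \<comment> \<open>The least integer strictly above \<open>C * ?r x\<close>, so a maximum load
      beyond the threshold is at least \<open>M\<close>.\<close>
    define M where "M = Suc (nat \<lfloor>C * ?r x\<rfloor>)"
    have r0: "?r x \<ge> 1" "?r x \<ge> y0" using elim(3) by auto
    have Cr: "C * ?r x \<ge> ?r x"
      using C r0 by (simp add: mult_le_cancel_right1)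
    have M_bds: "C * ?r x \<le> real M" "real M \<le> C * ?r x + 1"
      using Cr r0 unfolding M_def by linarith+
    have x1: "x powr (1 / real d) = real m"
      using d elim(5) by (simp add: x_def powr_realpow[symmetric] powr_powr)
    have Mm: "M \<le> m"
      using M_bds(2) elim(1) x1 by linarith
    have M1: "1 \<le> M" by (simp add: M_def)
    have M_r: "?r x \<le> real M" using M_bds(1) Cr by linarith
    have Mpos: "real M > 0" using M1 by simp
    have x0: "x > 0" using elim(5) by (simp add: x_def)
    have "P m \<le> measure_pmf.prob (loads (grid_vertices d m) (grid_edges d m) (m ^ d))
        {x. M \<le> max_load (grid_vertices d m) x}"
      unfolding P_def x_def[symmetric]
    proof (intro measure_pmf.finite_measure_mono subsetI CollectI)
      fix y assume "y \<in> {y. C * ?r x < real (max_load (grid_vertices d m) y)}"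
      then show "M \<le> max_load (grid_vertices d m) y"
        using Cr r0 unfolding M_def by (simp, linarith)
    qed simp
    also have "\<dots> \<le> x * exp (5 ^ d * real M ^ d * sqrt (real M) - \<kappa> * real M ^ (d + 1) * ln (real M) / 2)"
      using prob_max_load_ge[OF d elim(5) M1 Mm] by (simp add: x_def \<kappa>_def)
    also have "\<dots> \<le> x * exp (- 2 * ln x)"
    proof (intro mult_left_mono iffD2[OF exp_le_cancel_iff])
      have "5 ^ d * real M ^ d * sqrt (real M) = real M ^ (d + 1) * (5 ^ d / sqrt (real M))"
        using Mpos by (simp add: field_simps)
      also have "\<dots> \<le> real M ^ (d + 1) * (\<kappa> / 4 * ln (real M))"
        using M_r r0 by (intro mult_left_mono y0) auto
      finally have 1: "5 ^ d * real M ^ d * sqrt (real M) - \<kappa> * real M ^ (d + 1) * ln (real M) / 2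
          \<le> - (\<kappa> / 4 * (real M ^ (d + 1) * ln (real M)))"
        by (simp add: algebra_simps)
      have q: "0 \<le> ln x / ln (ln x)"
        using elim(4) by (intro divide_nonneg_nonneg) auto
      have "C * (ln x / ln (ln x)) \<le> C ^ (d + 1) * (ln x / ln (ln x))"
        using C q by (intro mult_right_mono self_le_power) auto
      also have "\<dots> = (C * ?r x) ^ (d + 1)"
        unfolding power_mult_distrib load_scale_power[OF q] ..
      also have "\<dots> \<le> real M ^ (d + 1)"
        using M_bds(1) C r0 by (intro power_mono) auto
      finally have 2: "C * (ln x / ln (ln x)) \<le> real M ^ (d + 1)" .
      have "ln (?r x) \<le> ln (real M)"
        using M_r r0 by simp
      then have 3: "ln (ln x) / (2 * (real d + 1)) \<le> ln (real M)"
        using elim(2) by linarith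
      have "2 * ln x = \<kappa> / 4 * (C * (ln x / ln (ln x)) * (ln (ln x) / (2 * (real d + 1))))"
      proof -
        have eq: "2 * a = \<kappa> / 4 * (16 * D / \<kappa> * (a / b) * (b / (2 * D)))" if "b > 0" "D > 0" for a b D :: real
          using that \<kappa>(1) by (simp add: field_simps)
        show ?thesis
          unfolding C_def by (rule eq) (use elim(4) in auto)
      qed
      also have "\<dots> \<le> \<kappa> / 4 * (real M ^ (d + 1) * ln (real M))"
        using \<kappa> elim(4) by (intro mult_left_mono mult_mono 2 3) auto
      finally show "5 ^ d * real M ^ d * sqrt (real M) - \<kappa> * real M ^ (d + 1) * ln (real M) / 2 \<le> - 2 * ln x"
        using 1 by linarith
    qed (use x0 in simp)
    also have "\<dots> = 1 / x"
    proof -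
      have "exp (- 2 * ln x) = inverse (exp (ln x) * exp (ln x))"
        by (simp flip: exp_add exp_minus)
      then show ?thesis
        using x0 by (simp add: field_simps)
    qed
    finally show "P m \<le> 1 / real (m ^ d)"
      by (simp add: x_def)
  qed
  moreover have "(\<lambda>m. 1 / real (m ^ d)) \<longlonglongrightarrow> 0"
    using tendsto_divide_0[OF tendsto_const filterlim_at_top_imp_at_infinity[OF lim]] .
  ultimately have "P \<longlonglongrightarrow> 0"
    by (intro tendsto_sandwich[of "\<lambda>_. 0" P _ "\<lambda>m. 1 / real (m ^ d)"]) (auto simp: P_def)
  with C show thesis
    using that unfolding P_def by blast
qed

section \<open>Lower tail of the maximum load\<close>

lemma prob_no_births_eq_le_exp:
  fixes V :: "'v set" and k :: nat
  assumes V: "finite V" "card V \<ge> 2" and k: "1 \<le> k" "k \<le> card V"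
  shows "measure_pmf.prob (births V (card V)) {b. \<forall>v\<in>V. b v \<noteq> k} \<le>
    exp 2 * real k ^ k / real (card V) + exp (4 * real k / real (card V)) - 1"
proof -
  define n where "n = card V"
  define a where "a = 1 - inv_card V"
  have V': "V \<noteq> {}" using V(2) by auto
  note inv = inv_card_def[OF V(1) V', folded n_def]
  have n: "real n \<ge> 2" using V(2) by (simp add: n_def)
  have a: "0 < a" "a \<le> 1" using n by (simp_all add: a_def inv)
  have inv_a: "1 / a \<le> exp (2 / real n)"
  proof -
    have "1 / a = 1 + 1 / (real n - 1)"
      using n by (simp add: a_def inv field_simps)
    also have "\<dots> \<le> exp (1 / (real n - 1))"
      by (rule exp_ge_add_one_self)
    also have "\<dots> \<le> exp (2 / real n)"
      using n by (simp add: field_simps)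
    finally show ?thesis .
  qed
  define \<mu> where "\<mu> = real n * (a ^ n * real (n choose k) * (inv_card V / a) ^ k)"
  \<comment> \<open>The binomial coefficient is at least \<open>(n / k) ^ k\<close>, and its
    \<open>n ^ k\<close> cancels against the power of \<open>inv_card\<close>.\<close>
  have "real n * (a ^ n * (1 / real k ^ k)) \<le> \<mu>"
  proof -
    have "1 / real k ^ k = (real n / real k) ^ k * inv_card V ^ k"
      using n k by (simp add: inv power_divide field_simps)
    also have "\<dots> \<le> real (n choose k) * (inv_card V / a) ^ k"
    proof (intro mult_mono power_mono)
      show "(real n / real k) ^ k \<le> real (n choose k)"
        using k by (intro binomial_ge_n_over_k_pow_k) (simp_all add: n_def)
      show "inv_card V \<le> inv_card V / a"
        using a n by (simp add: inv field_simps)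
    qed (use n a in \<open>auto simp: inv\<close>)
    finally show ?thesis
      unfolding \<mu>_def mult.assoc using a by (intro mult_left_mono) auto
  qed
  moreover have "real n * (a ^ n * (1 / real k ^ k)) > 0"
    using a n k by simp
  ultimately have \<mu>: "\<mu> > 0" "1 / \<mu> \<le> 1 / (real n * (a ^ n * (1 / real k ^ k)))"
    by (linarith, intro frac_le) auto
  have "1 / (real n * (a ^ n * (1 / real k ^ k))) = (1 / a) ^ n * real k ^ k / real n"
    using a n k by (simp add: field_simps)
  also have "\<dots> \<le> exp (2 / real n) ^ n * real k ^ k / real n"
    using a n inv_a by (intro divide_right_mono mult_right_mono power_mono) auto
  also have "exp (2 / real n) ^ n = exp 2"
    using n by (simp flip: exp_of_nat_mult)
  finally have 1: "1 / \<mu> \<le> exp 2 * real k ^ k / real n"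
    using \<mu>(2) by linarith
  have "1 / a ^ (2 * k) = (1 / a) ^ (2 * k)"
    by (simp add: power_divide)
  also have "\<dots> \<le> exp (2 / real n) ^ (2 * k)"
    using a inv_a by (intro power_mono) auto
  also have "\<dots> = exp (4 * real k / real n)"
    by (simp flip: exp_of_nat_mult)
  finally have 2: "1 / a ^ (2 * k) \<le> exp (4 * real k / real n)" .
  have "measure_pmf.prob (births V n) {b. \<forall>v\<in>V. b v \<noteq> k} \<le> 1 / \<mu> + 1 / a ^ (2 * k) - 1"
    using prob_no_births_eq_le[OF V(1) V' V(2), of n k] \<mu>(1)
    unfolding \<mu>_def a_def n_def by blast
  then show ?thesis
    using 1 2 unfolding n_def by linarith
qed

text \<open>For \<open>k\<close> about \<open>ln x / (2 * ln (ln x))\<close>, \<open>k ^ k\<close>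
  is at most \<open>sqrt x\<close>, so with high probability some vertex has exactly
  \<open>k\<close> births. This forces \<open>k \<le> 3 ^ d * M ^ (d + 1)\<close> for the maximum
  load \<open>M\<close>.\<close>

lemma max_load_lower:
  assumes d: "d \<ge> 1"
  obtains c where "0 < c" "c \<le> 1"
    and "(\<lambda>m. measure_pmf.prob (loads (grid_vertices d m) (grid_edges d m) (m ^ d))
      {x. real (max_load (grid_vertices d m) x) < c * load_scale d (real (m ^ d))}) \<longlonglongrightarrow> 0"
proof -
  \<comment> \<open>One factor 2 comes from \<open>k\<close>, one from its rounding, and
    \<open>3 ^ d\<close> from \<open>2 * M + 1 \<le> 3 * M\<close>.\<close>
  define c :: real where "c = 1 / (4 * 3 ^ d)"
  have "(1::real) \<le> 3 ^ d" by (rule one_le_power) simp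
  then have "(1::real) \<le> 4 * 3 ^ d" by linarith
  then have c: "0 < c" "c \<le> 1"
    by (simp_all add: c_def divide_le_eq_1)
  let ?r = "load_scale d"
  define P where "P = (\<lambda>m. measure_pmf.prob (loads (grid_vertices d m) (grid_edges d m) (m ^ d))
      {x. real (max_load (grid_vertices d m) x) < c * ?r (real (m ^ d))})"
  define F where "F = (\<lambda>x::real. exp 2 / sqrt x + exp (4 * ln x / x) - 1)"
  note lim = filterlim_real_power_at_top[OF d]
  have ev: "\<forall>\<^sub>F x::real in at_top. 2 \<le> ln x / (2 * ln (ln x)) \<and> 1 \<le> ln (ln x) \<and> ln x \<le> x \<and> 2 \<le> x"
    by (intro eventually_conj; real_asymp)
  have "\<forall>\<^sub>F m in sequentially. P m \<le> F (real (m ^ d))"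
    using eventually_compose_filterlim[OF ev lim] eventually_ge_at_top[of 2]
  proof eventually_elim
    case (elim m)
    define x where "x = real (m ^ d)"
    note elim = elim[folded x_def]
    let ?V = "grid_vertices d m"
    define k where "k = nat \<lfloor>ln x / (2 * ln (ln x))\<rfloor>"
    have x2: "2 \<le> x" "ln x \<le> x" and lnln: "1 \<le> ln (ln x)" and q: "2 \<le> ln x / (2 * ln (ln x))"
      using elim by auto
    have lnx: "ln x > 0" using x2 by simp
    have k1: "1 \<le> k"
      using q unfolding k_def by linarith
    have k_le: "real k \<le> ln x / (2 * ln (ln x))"
      using q unfolding k_def by linarith
    have k_ge: "ln x / (2 * ln (ln x)) / 2 \<le> real k"
    proof -
      have "y / 2 \<le> real (nat \<lfloor>y\<rfloor>)" if "2 \<le> y" for y :: real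
        using that by linarith
      from this[OF q] show ?thesis unfolding k_def .
    qed
    have "ln x / (2 * ln (ln x)) \<le> ln x"
    proof -
      have "a / (2 * b) \<le> a" if "1 \<le> b" "0 < a" for a b :: real
        using that by (simp add: field_simps)
      from this[OF lnln lnx] show ?thesis .
    qed
    then have k_ln: "real k \<le> ln x"
      using k_le by linarith
    have V: "finite ?V" "card ?V = m ^ d"
      by (simp_all add: finite_grid_vertices card_grid_vertices)
    have n2: "2 \<le> card ?V"
      using x2(1) unfolding V(2) x_def by linarith
    have kn: "k \<le> card ?V"
      using k_ln x2(2) unfolding V(2) x_def by linarith
    have "P m \<le> measure_pmf.prob (births ?V (m ^ d)) {b. \<forall>v\<in>?V. b v \<noteq> k}"
      unfolding P_def
    proof (rule prob_loads_le_births, safe)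
      fix y b v
      assume yb: "(y, b) \<in> set_pmf (loads_births ?V (grid_edges d m) (m ^ d))"
        and y: "real (max_load ?V y) < c * ?r (real (m ^ d))" and v: "v \<in> ?V" and k: "k = b v"
      define M where "M = max_load ?V y"
      have "k \<le> M * (2 * M + 1) ^ d"
        using grid_births_le_max_load[OF _ yb v] elim(2) k by (simp add: M_def)
      also have "\<dots> \<le> M * (3 * M) ^ d"
      proof (cases "M = 0")
        case False
        then have "2 * M + 1 \<le> 3 * M" by linarith
        then show ?thesis by (intro mult_left_mono power_mono) simp_all
      qed simp
      finally have "real k \<le> real (M * (3 * M) ^ d)"
        by (simp only: of_nat_le_iff)
      then have kM: "real k \<le> 3 ^ d * real M ^ (d + 1)"
        by (simp add: power_mult_distrib mult_ac)
      have q0: "0 \<le> ln x / ln (ln x)"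
        using lnln lnx by (intro divide_nonneg_nonneg) linarith+
      have "(c * ?r x) ^ (d + 1) = c ^ (d + 1) * (ln x / ln (ln x))"
        unfolding power_mult_distrib load_scale_power[OF q0] ..
      also have "\<dots> \<le> c * (ln x / ln (ln x))"
        using c power_decreasing[of 1 "d + 1" c] by (intro mult_right_mono q0) auto
      also have "\<dots> = ln x / (2 * ln (ln x)) / 2 / 3 ^ d"
        by (simp add: c_def)
      also have "\<dots> \<le> real k / 3 ^ d"
        by (intro divide_right_mono k_ge) simp
      also have "\<dots> \<le> real M ^ (d + 1)"
        using kM by (simp add: field_simps)
      finally have "c * ?r x \<le> real M"
        using power_le_imp_le_base[of "c * ?r x" d "real M"] by simp
      then show False
        using y by (simp add: M_def x_def)
    qed
    also have "\<dots> \<le> exp 2 * real k ^ k / x + exp (4 * real k / x) - 1"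
      using prob_no_births_eq_le_exp[OF V(1) n2 k1 kn] unfolding V(2) x_def .
    also have "\<dots> \<le> F x"
    proof -
      have "real k ^ k = exp (real k * ln (real k))"
        using k1 by (simp add: exp_of_nat_mult)
      \<comment> \<open>The sharp bound on \<open>k\<close> serves for the first factor, the crude
        \<open>k \<le> ln x\<close> for the logarithm; the product is half of
        \<open>ln x\<close>.\<close>
      also have "\<dots> \<le> exp (ln x / (2 * ln (ln x)) * ln (ln x))"
        unfolding exp_le_cancel_iff using k_ln k1 q by (intro mult_mono k_le) auto
      also have "\<dots> = exp (ln (sqrt x))"
      proof -
        have "a / (2 * b) * b = a / 2" if "1 \<le> b" for a b :: real
          using that by simp
        from this[OF lnln] show ?thesis
          using x2(1) by (simp only: ln_sqrt)
      qed
      also have "\<dots> = sqrt x"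
        using x2 by simp
      finally have "real k ^ k \<le> sqrt x" .
      then have "exp 2 * real k ^ k / x \<le> exp 2 * sqrt x / x"
        using x2 by (intro divide_right_mono mult_left_mono) auto
      also have "\<dots> = exp 2 / sqrt x"
        using x2 by (simp add: field_simps)
      finally have "exp 2 * real k ^ k / x \<le> exp 2 / sqrt x" .
      moreover have "exp (4 * real k / x) \<le> exp (4 * ln x / x)"
        using k_ln x2 by (simp add: divide_right_mono)
      ultimately show ?thesis
        unfolding F_def by linarith
    qed
    finally show "P m \<le> F (real (m ^ d))"
      by (simp add: x_def)
  qed
  moreover have "(\<lambda>m. F (real (m ^ d))) \<longlonglongrightarrow> 0"
  proof (rule filterlim_compose[OF _ lim])
    show "(F \<longlongrightarrow> 0) at_top"
      unfolding F_def by real_asymp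
  qed
  ultimately have "P \<longlonglongrightarrow> 0"
    by (intro tendsto_sandwich[of "\<lambda>_. 0" P _ "\<lambda>m. F (real (m ^ d))"]) (auto simp: P_def)
  with c show thesis
    using that unfolding P_def by blast
qed

text \<open>The number of vertices runs through the powers \<open>m ^ d\<close>, so the limit is
  taken in the side length \<open>m\<close>. The complement of the event is covered by the two
  tails.\<close>

theorem theorem1p3:
  fixes d :: nat
  assumes "d \<ge> 1"
  shows "\<exists>c C :: real. 0 < c \<and> c \<le> C \<and>
    (\<lambda>m. measure_pmf.prob (loads (grid_vertices d m) (grid_edges d m) (m ^ d))
       {x. c * (ln (real (m ^ d)) / ln (ln (real (m ^ d)))) powr (1 / (real d + 1))
             \<le> real (max_load (grid_vertices d m) x) \<and>
           real (max_load (grid_vertices d m) x)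
             \<le> C * (ln (real (m ^ d)) / ln (ln (real (m ^ d)))) powr (1 / (real d + 1))})
    \<longlonglongrightarrow> 1"
proof -
  obtain c where c: "0 < c" "c \<le> 1"
    and low: "(\<lambda>m. measure_pmf.prob (loads (grid_vertices d m) (grid_edges d m) (m ^ d))
      {x. real (max_load (grid_vertices d m) x) < c * load_scale d (real (m ^ d))}) \<longlonglongrightarrow> 0"
      (is "?L \<longlonglongrightarrow> 0")
    using max_load_lower[OF assms] .
  obtain C where C: "C \<ge> 1"
    and high: "(\<lambda>m. measure_pmf.prob (loads (grid_vertices d m) (grid_edges d m) (m ^ d))
      {x. C * load_scale d (real (m ^ d)) < real (max_load (grid_vertices d m) x)}) \<longlonglongrightarrow> 0"
      (is "?H \<longlonglongrightarrow> 0")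
    using max_load_upper[OF assms] .
  define G where "G = (\<lambda>m. measure_pmf.prob (loads (grid_vertices d m) (grid_edges d m) (m ^ d))
      {x. c * load_scale d (real (m ^ d)) \<le> real (max_load (grid_vertices d m) x) \<and>
          real (max_load (grid_vertices d m) x) \<le> C * load_scale d (real (m ^ d))})"
  have "1 - (?L m + ?H m) \<le> G m" for m
  proof -
    let ?p = "loads (grid_vertices d m) (grid_edges d m) (m ^ d)"
    let ?X = "\<lambda>x. real (max_load (grid_vertices d m) x)" and ?r = "load_scale d (real (m ^ d))"
    have "1 - G m = measure_pmf.prob ?p (UNIV - {x. c * ?r \<le> ?X x \<and> ?X x \<le> C * ?r})"
      unfolding G_def using measure_pmf.prob_compl[of _ ?p] by simp
    also have "\<dots> \<le> measure_pmf.prob ?p ({x. ?X x < c * ?r} \<union> {x. C * ?r < ?X x})"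
      by (intro measure_pmf.finite_measure_mono) auto
    also have "\<dots> \<le> ?L m + ?H m"
      by (rule measure_Un_le) auto
    finally show ?thesis by simp
  qed
  moreover have "(\<lambda>m. 1 - (?L m + ?H m)) \<longlonglongrightarrow> 1 - (0 + 0)"
    by (intro tendsto_intros low high)
  ultimately have "G \<longlonglongrightarrow> 1"
    by (intro tendsto_sandwich[of "\<lambda>m. 1 - (?L m + ?H m)" G _ "\<lambda>_. 1"]) (auto simp: G_def)
  then show ?thesis
    using c C unfolding G_def load_scale_def by (intro exI[of _ c] exI[of _ C]) auto
qed

end
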